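(* Let $(\Omega,d)$ be a compact metric space and let $T:\Omega\to\Omega$ be a homeomorphism that is ergodic with respect to some $T$-invariant Borel probability measure on $\Omega$. Suppose that $\alpha\in PRP(T)$ and that $\{T^n\alpha\}_{n\geq 0}$ is dense in $\Omega$. Then there exists a residual subset $\mathcal{F}$ of $C(\Omega)$ such that for every $f\in\mathcal{F}$ there exists a residual subset $\Omega_f$ of $\Omega$ with the property that, for every $\omega\in\Omega_f$, the function $\mathbb{Z}\to\mathbb{R}$, $n\mapsto f(T^n\omega)$, is a Gordon potential.
   Context: $C(\Omega)$ is the space of continuous functions $f:\Omega\to\mathbb{R}$ with the supremum norm. A subset of a topological space is residual if it contains a countable intersection of open dense subsets. $\mathbb{Z}_+$ denotes the positive integers. A sequence $\{\omega_n\}_{n\ge 0}$ in $\Omega$ satisfies the repetition property (RP) if for all $\varepsilon>0$ and $r\in\mathbb{Z}_+$ there exists $q\in\mathbb{Z}_+$ such that $d(\omega_n,\omega_{n+q})<\varepsilon$ for all $n\in\{0,1,\dots,rq\}$. $PRP(T)$ is the set of $\omega\in\Omega$ such that $\{T^n\omega\}_{n\ge0}$ satisfies RP. A bounded function $V:\mathbb{Z}\to\mathbb{R}$ is a Gordon potential if there exist positive integers $T_m$ $(m\in\mathbb{Z}_+)$ with $T_m\to\infty$ and functions $V_m:\mathbb{Z}\to\mathbb{R}$ $(m\in\mathbb{Z}_+)$ with $V_m(n+T_m)=V_m(n)$ for all $n\in\mathbb{Z}$, such that (i) $\sup_{n,m}|V_m(n)|<\infty$, and (ii) there is $C>0$ with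 $\sup_{|n|\le 2T_m}|V_m(n)-V(n)|\le C m^{-T_m}$ for all $m\in\mathbb{Z}_+$. *)

theory Defs
  imports "HOL-Probability.Probability"
begin

definition residual :: "'a::topological_space set \<Rightarrow> bool" where
  "residual A \<longleftrightarrow>
     (\<exists>\<U>. countable \<U> \<and> (\<forall>U\<in>\<U>. open U \<and> closure U = UNIV) \<and> \<Inter>\<U> \<subseteq> A)"

definition repetition_property :: "(nat \<Rightarrow> 'a::metric_space) \<Rightarrow> bool" where
  "repetition_property w \<longleftrightarrow>
     (\<forall>\<epsilon>>0. \<forall>r>0. \<exists>q>0. \<forall>n\<in>{0..r * q}. dist (w n) (w (n + q)) < \<epsilon>)"

definition PRP :: "('a::metric_space \<Rightarrow> 'a) \<Rightarrow> 'a set" where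
  "PRP T = {w. repetition_property (\<lambda>n. (T ^^ n) w)}"

text \<open>
  Iterates with integer exponents; the map is meant to be a bijection, since negative exponents
  iterate its inverse.
\<close>

definition int_iter :: "('a \<Rightarrow> 'a) \<Rightarrow> int \<Rightarrow> 'a \<Rightarrow> 'a" where
  "int_iter T n = (if 0 \<le> n then T ^^ nat n else inv T ^^ nat (- n))"

definition ergodic_borel_prob :: "('a::topological_space \<Rightarrow> 'a) \<Rightarrow> 'a measure \<Rightarrow> bool" where
  "ergodic_borel_prob T \<mu> \<longleftrightarrow>
     prob_space \<mu> \<and> sets \<mu> = sets borel \<and>
     T \<in> measurable \<mu> \<mu> \<and> distr \<mu> \<mu> T = \<mu> \<and>
     (\<forall>A\<in>sets \<mu>. T -` A = A \<longrightarrow> measure \<mu> A = 0 \<or> measure \<mu> A = 1)"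

text \<open>
  The approximating potentials are indexed by positive integers, so the values of \<open>\<tau>\<close> and \<open>W\<close> at
  index 0 are never constrained.
\<close>

definition gordon_potential :: "(int \<Rightarrow> real) \<Rightarrow> bool" where
  "gordon_potential V \<longleftrightarrow>
     bounded (range V) \<and>
     (\<exists>(\<tau> :: nat \<Rightarrow> nat) (W :: nat \<Rightarrow> int \<Rightarrow> real).
        (\<forall>m\<ge>1. \<tau> m > 0) \<and> filterlim \<tau> at_top sequentially \<and>
        (\<forall>m\<ge>1. \<forall>n. W m (n + int (\<tau> m)) = W m n) \<and>
        bdd_above {\<bar>W m n\<bar> | m n. m \<ge> 1} \<and>
        (\<exists>C>0. \<forall>m\<ge>1.
           (SUP n\<in>{n. \<bar>n\<bar> \<le> 2 * int (\<tau> m)}. \<bar>W m n - V n\<bar>)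
             \<le> C * real m powi (- int (\<tau> m))))"

end

theory Submission
  imports Defs
begin

text \<open>
  Say that \<open>V\<close> has an \<open>e\<close>-repetition of period \<open>q\<close> if \<open>\<bar>V (n + q) - V n\<bar> < e\<close> for
  \<open>-2q \<le> n \<le> q\<close>, so that \<open>V\<close> runs through nearly the same block of length \<open>q\<close> four times in a
  row on \<open>[-2q, 2q]\<close>. A bounded \<open>V\<close> having, for each \<open>m\<close>, such a repetition of some period
  \<open>q \<ge> m\<close> with \<open>e = m\<^sup>-\<^sup>q\<close> is a Gordon potential: repeat one of its blocks periodically
  (lemma \<open>gordon_potential_of_repetitions\<close>). For fixed \<open>m\<close> and \<open>q\<close>, this condition on
  \<open>n \<mapsto> f (T\<^sup>n \<omega>)\<close> consists of finitely many strict inequalities between values of \<open>f\<close>; hence,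
  also after taking the union over \<open>q \<ge> m\<close>, it is open in \<open>\<omega>\<close> for fixed \<open>f\<close>, and open in \<open>f\<close>
  for fixed \<open>\<omega>\<close>.

  It remains to see that, for generic \<open>f\<close>, these open sets of points \<open>\<omega>\<close> are dense. As the orbit
  of \<open>\<alpha>\<close> is dense, countably many conditions on \<open>f\<close> suffice, one for each \<open>m\<close> and each ball of
  radius \<open>1/(j+1)\<close> about an orbit point \<open>T\<^sup>k \<alpha>\<close>: the ball shall contain a point of the open set.
  Each is an open condition on \<open>f\<close>, and it is dense because of the repetition property. If
  \<open>\<alpha>\<close> is periodic this is immediate. Otherwise the orbit of \<open>\<alpha>\<close> is injective and
  repeats approximately with arbitrarily large periods \<open>q\<close> along times up to \<open>5q\<close>. By
  uniform continuity \<open>f\<close> is nearly \<open>q\<close>-periodic on this finite orbit piece, and a small Tietze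
  correction makes it exactly \<open>q\<close>-periodic there (lemma \<open>periodic_perturbation\<close>). The point
  \<open>T\<^bsup>k+2q\<^esup> \<alpha>\<close>, which lies in the middle of that piece, has the required repetition, and two
  approximate returns show that it is close to \<open>T\<^sup>k \<alpha>\<close>.
\<close>

section \<open>Gordon potentials from repeated blocks\<close>

definition has_repetition :: "real \<Rightarrow> nat \<Rightarrow> (int \<Rightarrow> real) \<Rightarrow> bool" where
  "has_repetition e q V \<longleftrightarrow> (\<forall>n\<in>{- 2 * int q..int q}. \<bar>V (n + int q) - V n\<bar> < e)"

lemma abs_diff_mod_le:
  fixes F :: "nat \<Rightarrow> real"
  assumes step: "\<And>j. j + q \<le> M \<Longrightarrow> \<bar>F (j + q) - F j\<bar> \<le> d"
    and "i \<le> M"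
  shows "\<bar>F i - F (i mod q)\<bar> \<le> real (i div q) * d"
proof -
  have "\<bar>F (a + l * q) - F a\<bar> \<le> real l * d" if "a + l * q \<le> M" for a l
    using that
  proof (induction l)
    case (Suc l)
    have "\<bar>F (a + l * q + q) - F (a + l * q)\<bar> \<le> d"
      using Suc.prems by (intro step) (simp add: algebra_simps)
    moreover have "\<bar>F (a + l * q) - F a\<bar> \<le> real l * d"
      using Suc by simp
    ultimately show ?case
      by (simp add: algebra_simps)
  qed simp
  from this[of "i mod q" "i div q"] show ?thesis
    using \<open>i \<le> M\<close> by (simp add: mod_div_mult_eq)
qed

text \<open>
  The periodic approximant repeats the block on \<open>[-2q, -q)\<close>. Every point of \<open>[-2q, 2q]\<close> is
  reached from this block by at most four shifts to the right, which gives the constant 4.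
\<close>

lemma gordon_potential_of_repetitions:
  assumes bdd: "bounded (range V)"
    and rep: "\<And>m. m \<ge> 1 \<Longrightarrow> \<exists>q\<ge>m. has_repetition (real m powi (- int q)) q V"
  shows "gordon_potential V"
proof -
  obtain \<tau> where \<tau>: "\<And>m. m \<ge> 1 \<Longrightarrow> \<tau> m \<ge> m"
    and rep\<tau>: "\<And>m. m \<ge> 1 \<Longrightarrow> has_repetition (real m powi (- int (\<tau> m))) (\<tau> m) V"
    using rep by metis
  obtain B where B: "\<And>n. \<bar>V n\<bar> \<le> B"
    using bdd by (auto simp: bounded_iff)
  define W where "W = (\<lambda>m n. V (n mod int (\<tau> m) - 2 * int (\<tau> m)))"
  have "filterlim \<tau> at_top sequentially"
    by (rule filterlim_at_top_mono[OF filterlim_ident], rule eventually_sequentiallyI[of 1])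
      (rule \<tau>)
  moreover have "(SUP n\<in>{n. \<bar>n\<bar> \<le> 2 * int (\<tau> m)}. \<bar>W m n - V n\<bar>)
      \<le> 4 * real m powi (- int (\<tau> m))" if m: "m \<ge> 1" for m
  proof (rule cSUP_least)
    show "{n. \<bar>n\<bar> \<le> 2 * int (\<tau> m)} \<noteq> {}"
      by (auto intro!: exI[of _ 0])
    fix n assume "n \<in> {n. \<bar>n\<bar> \<le> 2 * int (\<tau> m)}"
    then have n: "- 2 * int (\<tau> m) \<le> n" "n \<le> 2 * int (\<tau> m)" by auto
    define q where "q = \<tau> m"
    define e where "e = real m powi (- int q)"
    have q: "q > 0" using \<tau>[OF m] m by (simp add: q_def)
    have e: "e > 0" using m by (simp add: e_def)
    define F where "F = (\<lambda>i. V (int i - 2 * int q))"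
    define i where "i = nat (n + 2 * int q)"
    have i: "int i = n + 2 * int q" "i \<le> 4 * q"
      using n by (auto simp: i_def q_def)
    have "\<bar>F (j + q) - F j\<bar> \<le> e" if "j + q \<le> 4 * q" for j
    proof -
      have "int j - 2 * int q \<in> {- 2 * int q..int q}" using that by auto
      then have "\<bar>V (int j - 2 * int q + int q) - V (int j - 2 * int q)\<bar> < e"
        using rep\<tau>[OF m] unfolding has_repetition_def q_def e_def by blast
      then show ?thesis by (simp add: F_def algebra_simps)
    qed
    then have "\<bar>F i - F (i mod q)\<bar> \<le> real (i div q) * e"
      using i(2) by (rule abs_diff_mod_le)
    also have "i div q \<le> 4"
      using div_le_mono[OF i(2), of q] q by simp
    then have "real (i div q) * e \<le> 4 * e" using e by (intro mult_right_mono) auto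
    also have "F i = V n" by (simp add: F_def i(1))
    also have "F (i mod q) = W m n"
      by (simp add: F_def W_def q_def zmod_int i(1)[unfolded q_def])
    finally show "\<bar>W m n - V n\<bar> \<le> 4 * real m powi (- int (\<tau> m))"
      by (simp add: e_def q_def abs_minus_commute)
  qed
  moreover have "bdd_above {\<bar>W m n\<bar> | m n. m \<ge> 1}"
    by (rule bdd_aboveI[of _ B]) (auto simp: W_def B)
  moreover have "\<forall>m\<ge>1. \<forall>n. W m (n + int (\<tau> m)) = W m n"
    by (simp add: W_def)
  moreover have "\<forall>m\<ge>1. \<tau> m > 0"
    using \<tau> by (metis le_trans less_eq_Suc_le One_nat_def)
  ultimately show ?thesis
    unfolding gordon_potential_def using bdd
    by (intro conjI exI[of _ \<tau>] exI[of _ W] exI[of _ "4::real"]) auto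
qed

section \<open>Integer iterates of a homeomorphism\<close>

lemma int_iter_funpow:
  assumes "bij T" and "0 \<le> n + int k"
  shows "int_iter T n ((T ^^ k) x) = (T ^^ nat (n + int k)) x"
proof (cases "0 \<le> n")
  case True
  then show ?thesis
    by (simp add: int_iter_def nat_add_distrib funpow_add)
next
  case False
  define l where "l = nat (- n)"
  have k: "k = l + nat (n + int k)" using assms(2) False by (simp add: l_def)
  have inv: "(inv T ^^ l) ((T ^^ l) y) = y" for y
    using assms(1) by (metis bij_def inv_fn inv_f_f inj_fn)
  have "(T ^^ k) x = (T ^^ l) ((T ^^ nat (n + int k)) x)"
    by (subst k) (simp add: funpow_add)
  then show ?thesis using False inv by (simp add: int_iter_def l_def)
qed

lemma continuous_on_funpow:
  assumes "continuous_on UNIV (f :: 'a::topological_space \<Rightarrow> 'a)"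
  shows "continuous_on UNIV (f ^^ n)"
proof (induction n)
  case (Suc n)
  then show ?case
    using continuous_on_compose[OF Suc continuous_on_subset[OF assms]] by simp
qed (simp add: id_def)

lemma continuous_on_int_iter:
  assumes "homeomorphism UNIV UNIV T S"
  shows "continuous_on UNIV (int_iter T n)"
proof -
  have "inv T = S"
    using assms by (intro inv_unique_comp) (auto simp: homeomorphism_def fun_eq_iff)
  then show ?thesis
    using assms by (auto simp: int_iter_def homeomorphism_def intro!: continuous_on_funpow)
qed

section \<open>Perturbing a function along a repeating orbit\<close>

lemma repetition_arbitrarily_large:
  assumes rp: "repetition_property w"
    and aperiodic: "\<And>i. i > 0 \<Longrightarrow> w i \<noteq> w 0"
    and "\<epsilon> > 0" "r > 0"
  obtains q where "q \<ge> N" "q > 0" "\<And>n. n \<le> r * q \<Longrightarrow> dist (w n) (w (n + q)) < \<epsilon>"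
proof -
  \<comment> \<open>Below this precision, no period shorter than \<open>N\<close> is possible, already at time 0.\<close>
  define \<eta> where "\<eta> = Min (insert \<epsilon> ((\<lambda>i. dist (w 0) (w i)) ` {1..<N}))"
  have "dist (w 0) (w i) > 0" if "i \<in> {1..<N}" for i
    using aperiodic[of i] that
    by (metis atLeastLessThan_iff less_eq_Suc_le One_nat_def zero_less_dist_iff)
  then have "\<eta> > 0" using \<open>\<epsilon> > 0\<close> unfolding \<eta>_def by (subst Min_gr_iff) blast+
  then obtain q where q: "q > 0" "\<And>n. n \<le> r * q \<Longrightarrow> dist (w n) (w (n + q)) < \<eta>"
    using rp \<open>r > 0\<close> unfolding repetition_property_def by (metis atLeastAtMost_iff zero_le)
  have "q \<ge> N"
  proof (rule ccontr)
    assume "\<not> q \<ge> N"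
    then have "dist (w 0) (w q) \<in> (\<lambda>i. dist (w 0) (w i)) ` {1..<N}"
      using q(1) by (intro imageI) auto
    then have "\<eta> \<le> dist (w 0) (w q)"
      unfolding \<eta>_def by (intro Min_le) blast+
    then show False using q(2)[of 0] by simp
  qed
  moreover have "\<eta> \<le> \<epsilon>" by (simp add: \<eta>_def)
  ultimately show ?thesis using q that by (meson less_le_trans)
qed

lemma continuous_interpolation_on_finite:
  fixes c :: "'a::metric_space \<Rightarrow> real"
  assumes "finite P" "\<And>x. x \<in> P \<Longrightarrow> \<bar>c x\<bar> \<le> B" "0 \<le> B"
  obtains h where "continuous_on UNIV h" "\<And>x. x \<in> P \<Longrightarrow> h x = c x" "\<And>x. \<bar>h x\<bar> \<le> B"
proof -
  have "normal_space (euclidean :: 'a topology)"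
    by (simp add: metrizable_imp_normal_space metrizable_space_euclidean)
  moreover have "closedin euclidean P"
    using assms(1) by (simp add: finite_imp_closed)
  moreover have "continuous_map (subtopology euclidean P) euclideanreal c"
    using assms(1) by (simp add: continuous_on_finite)
  moreover have "c ` P \<subseteq> {-B..B}" using assms(2) by (force simp: abs_le_iff)
  ultimately obtain g where "continuous_map euclidean euclideanreal g"
    "\<And>x. x \<in> P \<Longrightarrow> g x = c x" "g ` topspace euclidean \<subseteq> {-B..B}"
    using Tietze_extension_closed_real_interval[of euclidean P c "-B" B] assms(3) by auto
  then show ?thesis
    by (intro that[of g]) (auto simp: abs_le_iff image_subset_iff minus_le_iff)
qed

text \<open>
  Injectivity of \<open>w\<close> is what allows the values of the correction at the points
  \<open>w 0, \<dots>, w (5 q)\<close> to be prescribed independently of each other. Each of these values of \<open>f\<close>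
  is moved to the value at the index reduced modulo \<open>q\<close>, at most five approximate periods away.
\<close>

lemma periodic_perturbation:
  fixes f :: "'a::metric_space \<Rightarrow>\<^sub>C real"
  assumes comp: "compact (UNIV :: 'a set)"
    and "inj w" and rp: "repetition_property w"
    and "e > 0" "\<rho> > 0"
  obtains g q where "q \<ge> N" "q > 0" "dist g f \<le> e"
    "\<And>i. i \<le> 4 * q \<Longrightarrow> apply_bcontfun g (w (i + q)) = apply_bcontfun g (w i)"
    "\<And>i. i \<le> 4 * q \<Longrightarrow> dist (w i) (w (i + q)) < \<rho>"
proof -
  have "uniformly_continuous_on UNIV (apply_bcontfun f)"
    using comp by (intro compact_uniformly_continuous) auto
  then obtain \<delta> where "\<delta> > 0"
    and \<delta>: "\<And>x y. dist x y < \<delta> \<Longrightarrow> dist (apply_bcontfun f x) (apply_bcontfun f y) < e / 5"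
    using \<open>e > 0\<close> unfolding uniformly_continuous_on_def
    by (metis UNIV_I divide_pos_pos zero_less_numeral)
  have "w i \<noteq> w 0" if "i > 0" for i
    using \<open>inj w\<close> that by (simp add: inj_eq)
  moreover have "min \<delta> \<rho> > 0" using \<open>\<delta> > 0\<close> \<open>\<rho> > 0\<close> by simp
  ultimately obtain q where q: "q \<ge> N" "q > 0"
    and close: "\<And>n. n \<le> 4 * q \<Longrightarrow> dist (w n) (w (n + q)) < min \<delta> \<rho>"
    using repetition_arbitrarily_large[OF rp, of "min \<delta> \<rho>" 4 N] by auto
  define F where "F i = apply_bcontfun f (w i)" for i
  have F: "\<bar>F i - F (i mod q)\<bar> \<le> e" if "i \<le> 5 * q" for i
  proof -
    have "\<bar>F (j + q) - F j\<bar> \<le> e / 5" if "j + q \<le> 5 * q" for j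
      using \<delta>[of "w j" "w (j + q)"] close[of j] that
      by (simp add: F_def dist_real_def abs_minus_commute)
    then have "\<bar>F i - F (i mod q)\<bar> \<le> real (i div q) * (e / 5)"
      using that by (rule abs_diff_mod_le)
    also have "i div q \<le> 5"
      using div_le_mono[OF that, of q] q by simp
    then have "real (i div q) * (e / 5) \<le> 5 * (e / 5)"
      using \<open>e > 0\<close> by (intro mult_right_mono) auto
    finally show ?thesis by simp
  qed
  define c where "c x = (let i = inv w x in F (i mod q) - F i)" for x
  have c: "c (w i) = F (i mod q) - F i" for i
    using \<open>inj w\<close> by (simp add: c_def)
  obtain h where h: "continuous_on UNIV h" "\<And>x. x \<in> w ` {..5 * q} \<Longrightarrow> h x = c x"
    "\<And>x. \<bar>h x\<bar> \<le> e"
    by (rule continuous_interpolation_on_finite[of "w ` {..5 * q}" c e])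
      (use F \<open>e > 0\<close> in \<open>auto simp: c abs_minus_commute\<close>)
  have "h \<in> bcontfun"
    using h by (intro bcontfun_normI[of h e]) auto
  then have hb: "apply_bcontfun (Bcontfun h) = h"
    by (rule Bcontfun_inverse)
  define g where "g = f + Bcontfun h"
  have g: "apply_bcontfun g (w i) = F (i mod q)" if "i \<le> 5 * q" for i
    using that by (simp add: g_def hb h(2) c) (simp add: F_def)
  show ?thesis
  proof (rule that[of q g])
    show "dist g f \<le> e"
      by (rule dist_bound) (simp add: g_def hb h(3) dist_real_def)
    show "apply_bcontfun g (w (i + q)) = apply_bcontfun g (w i)" if "i \<le> 4 * q" for i
      using g[of i] g[of "i + q"] that by simp
    show "dist (w i) (w (i + q)) < \<rho>" if "i \<le> 4 * q" for i
      using close[OF that] by simp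
  qed (use q in auto)
qed

text \<open>
  As \<open>T\<close> is injective, an orbit that visits some point twice is periodic. A periodic orbit repeats
  exactly, and \<open>f\<close> itself serves as perturbation; on any other orbit the preceding lemma applies.
\<close>

lemma periodic_perturbation_orbit:
  fixes T :: "'a::metric_space \<Rightarrow> 'a" and f :: "'a \<Rightarrow>\<^sub>C real"
  assumes comp: "compact (UNIV :: 'a set)"
    and "inj T" and prp: "\<alpha> \<in> PRP T"
    and "e > 0" "\<rho> > 0"
  obtains g q where "q \<ge> N" "q > 0" "dist g f \<le> e"
    "\<And>i. i \<le> 4 * q \<Longrightarrow> apply_bcontfun g ((T ^^ (i + q)) \<alpha>) = apply_bcontfun g ((T ^^ i) \<alpha>)"
    "\<And>i. i \<le> 4 * q \<Longrightarrow> dist ((T ^^ i) \<alpha>) ((T ^^ (i + q)) \<alpha>) < \<rho>"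
proof (cases "\<exists>p>0. (T ^^ p) \<alpha> = \<alpha>")
  case True
  then obtain p where p: "p > 0" "(T ^^ p) \<alpha> = \<alpha>" by blast
  define q where "q = p * Suc N"
  have "(T ^^ (i + q)) \<alpha> = (T ^^ i) \<alpha>" for i
    using funpow_mod_eq[OF p(2), of i] funpow_mod_eq[OF p(2), of "i + q"]
    by (simp add: q_def del: mult_Suc_right)
  moreover have "q \<ge> N" using mult_le_mono1[of 1 p "Suc N"] p(1) by (simp add: q_def)
  moreover have "q > 0" using p(1) by (simp add: q_def)
  ultimately show ?thesis using \<open>e > 0\<close> \<open>\<rho> > 0\<close> by (intro that[of q f]) auto
next
  case False
  have neq: "(T ^^ i) \<alpha> \<noteq> (T ^^ j) \<alpha>" if "i < j" for i j
  proof
    assume eq: "(T ^^ i) \<alpha> = (T ^^ j) \<alpha>"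
    have "(T ^^ j) \<alpha> = (T ^^ i) ((T ^^ (j - i)) \<alpha>)"
      using that by (metis add_diff_inverse_nat comp_apply funpow_add less_imp_not_less)
    then have "(T ^^ (j - i)) \<alpha> = \<alpha>"
      using eq inj_fn[OF \<open>inj T\<close>, of i] by (simp add: inj_eq)
    then show False using False that by (metis zero_less_diff)
  qed
  have "inj (\<lambda>n. (T ^^ n) \<alpha>)"
    by (rule linorder_injI) (rule neq)
  moreover have "repetition_property (\<lambda>n. (T ^^ n) \<alpha>)"
    using prp by (simp add: PRP_def)
  ultimately show ?thesis
    by (rule periodic_perturbation[OF comp _ _ \<open>e > 0\<close> \<open>\<rho> > 0\<close>, of "\<lambda>n. (T ^^ n) \<alpha>" N f])
      (rule that)
qed

section \<open>The open dense sets\<close>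

definition repetition_points :: "('a::metric_space \<Rightarrow> 'a) \<Rightarrow> nat \<Rightarrow> ('a \<Rightarrow>\<^sub>C real) \<Rightarrow> 'a set" where
  "repetition_points T m f =
     {\<omega>. \<exists>q\<ge>m. has_repetition (real m powi (- int q)) q (\<lambda>n. apply_bcontfun f (int_iter T n \<omega>))}"

lemma open_has_repetition:
  fixes V :: "'b::topological_space \<Rightarrow> int \<Rightarrow> real"
  assumes "\<And>n. continuous_on UNIV (\<lambda>x. V x n)"
  shows "open {x. has_repetition e q (V x)}"
proof -
  have "{x. has_repetition e q (V x)} =
      (\<Inter>n\<in>{- 2 * int q..int q}. {x. \<bar>V x (n + int q) - V x n\<bar> < e})"
    by (auto simp: has_repetition_def)
  also have "open \<dots>"
    by (intro open_INT ballI open_Collect_less continuous_intros assms) auto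
  finally show ?thesis .
qed

lemma open_repetition_points:
  assumes "homeomorphism UNIV UNIV T S"
  shows "open (repetition_points T m f)"
proof -
  have "repetition_points T m f = (\<Union>q\<in>{m..}.
      {\<omega>. has_repetition (real m powi (- int q)) q (\<lambda>n. apply_bcontfun f (int_iter T n \<omega>))})"
    by (auto simp: repetition_points_def)
  also have "open \<dots>"
    by (intro open_UN ballI open_has_repetition
        continuous_on_compose2[OF continuous_on_apply_bcontfun[of UNIV f]]
        continuous_on_int_iter[OF assms]) auto
  finally show ?thesis .
qed

lemma continuous_on_eval_bcontfun:
  "continuous_on UNIV (\<lambda>f :: 'a::topological_space \<Rightarrow>\<^sub>C real. apply_bcontfun f x)"
  unfolding continuous_on_iff using dist_fun_lt_imp_dist_val_lt by blast

lemma open_repetition_functions: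
  "open {f. repetition_points T m f \<inter> A \<noteq> {}}"
proof -
  have "{f. repetition_points T m f \<inter> A \<noteq> {}} = (\<Union>\<omega>\<in>A. \<Union>q\<in>{m..}.
      {f. has_repetition (real m powi (- int q)) q (\<lambda>n. apply_bcontfun f (int_iter T n \<omega>))})"
    by (auto simp: repetition_points_def)
  also have "open \<dots>"
    by (intro open_UN ballI open_has_repetition continuous_on_eval_bcontfun)
  finally show ?thesis .
qed

text \<open>
  The window \<open>[-2q, q]\<close> around the point \<open>T\<^bsup>k+2q\<^esup> \<alpha>\<close> occupies the times \<open>k, \<dots>, k + 3q\<close> of
  the orbit of \<open>\<alpha>\<close>; this lies within the times up to \<open>4q\<close> controlled by the perturbation as soon
  as \<open>q \<ge> k\<close>.
\<close>

lemma dense_repetition_functions: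
  fixes T :: "'a::metric_space \<Rightarrow> 'a"
  assumes comp: "compact (UNIV :: 'a set)"
    and "bij T" and prp: "\<alpha> \<in> PRP T"
    and "m \<ge> 1" "\<rho> > 0"
  shows "closure {f. repetition_points T m f \<inter> ball ((T ^^ k) \<alpha>) \<rho> \<noteq> {}} = UNIV"
proof -
  have "\<exists>g. repetition_points T m g \<inter> ball ((T ^^ k) \<alpha>) \<rho> \<noteq> {} \<and> dist g f < e"
    if "e > 0" for f e
  proof -
    have "inj T" using \<open>bij T\<close> by (rule bij_is_inj)
    have "e / 2 > 0" "\<rho> / 2 > 0" using \<open>e > 0\<close> \<open>\<rho> > 0\<close> by auto
    obtain g q where q: "q \<ge> max m k" "q > 0" and gf: "dist g f \<le> e / 2"
      and per: "\<And>i. i \<le> 4 * q \<Longrightarrow>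
        apply_bcontfun g ((T ^^ (i + q)) \<alpha>) = apply_bcontfun g ((T ^^ i) \<alpha>)"
      and ret: "\<And>i. i \<le> 4 * q \<Longrightarrow> dist ((T ^^ i) \<alpha>) ((T ^^ (i + q)) \<alpha>) < \<rho> / 2"
      by (rule periodic_perturbation_orbit[OF comp \<open>inj T\<close> prp \<open>e / 2 > 0\<close> \<open>\<rho> / 2 > 0\<close>,
            of "max m k" f]) (rule that)
    define \<omega> where "\<omega> = (T ^^ (k + 2 * q)) \<alpha>"
    have "dist ((T ^^ k) \<alpha>) ((T ^^ (k + q)) \<alpha>) < \<rho> / 2"
      using q by (intro ret) auto
    moreover have "dist ((T ^^ (k + q)) \<alpha>) \<omega> < \<rho> / 2"
    proof -
      have "k + 2 * q = k + q + q" "k + q \<le> 4 * q" using q by auto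
      then show ?thesis unfolding \<omega>_def by (metis ret)
    qed
    ultimately have "\<omega> \<in> ball ((T ^^ k) \<alpha>) \<rho>"
      unfolding mem_ball by (metis dist_triangle_half_l dist_commute)
    moreover have "apply_bcontfun g (int_iter T (n + int q) \<omega>)
        = apply_bcontfun g (int_iter T n \<omega>)" if n: "n \<in> {- 2 * int q..int q}" for n
    proof -
      define i where "i = nat (n + int (k + 2 * q))"
      have "int_iter T n \<omega> = (T ^^ i) \<alpha>"
        unfolding \<omega>_def i_def using n by (intro int_iter_funpow \<open>bij T\<close>) auto
      moreover have "int_iter T (n + int q) \<omega> = (T ^^ nat (n + int q + int (k + 2 * q))) \<alpha>"
        unfolding \<omega>_def using n by (intro int_iter_funpow \<open>bij T\<close>) auto
      moreover have "nat (n + int q + int (k + 2 * q)) = i + q"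
        using n by (auto simp: i_def)
      moreover have "i \<le> 4 * q" using n q by (auto simp: i_def)
      ultimately show ?thesis using per by simp
    qed
    then have "\<omega> \<in> repetition_points T m g"
      using q \<open>m \<ge> 1\<close> by (auto simp: repetition_points_def has_repetition_def intro!: exI[of _ q])
    ultimately show ?thesis using gf \<open>e > 0\<close> by (intro exI[of _ g]) auto
  qed
  then show ?thesis
    by (auto simp: closure_approachable)
qed

lemma residual_INT:
  assumes "countable I" "\<And>i. i \<in> I \<Longrightarrow> open (U i)" "\<And>i. i \<in> I \<Longrightarrow> closure (U i) = UNIV"
  shows "residual (\<Inter>i\<in>I. U i)"
  unfolding residual_def using assms by (intro exI[of _ "U ` I"]) auto

theorem theoremA:
  fixes T :: "'a::metric_space \<Rightarrow> 'a" and \<alpha> :: 'a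
  assumes "compact (UNIV :: 'a set)"
    and "\<exists>S. homeomorphism UNIV UNIV T S"
    and "\<exists>\<mu>. ergodic_borel_prob T \<mu>"
    and "\<alpha> \<in> PRP T"
    and "closure (range (\<lambda>n::nat. (T ^^ n) \<alpha>)) = UNIV"
  shows "\<exists>\<F> :: ('a \<Rightarrow>\<^sub>C real) set. residual \<F> \<and>
           (\<forall>f\<in>\<F>. \<exists>\<Omega>\<^sub>f :: 'a set. residual \<Omega>\<^sub>f \<and>
              (\<forall>\<omega>\<in>\<Omega>\<^sub>f. gordon_potential (\<lambda>n. apply_bcontfun f (int_iter T n \<omega>))))"
proof -
  obtain S where S: "homeomorphism UNIV UNIV T S" using assms(2) by blast
  then have "bij T"
    by (intro o_bij[of S]) (auto simp: homeomorphism_def fun_eq_iff)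
  define G where "G = (\<lambda>(m, k, j). {f. repetition_points T m f \<inter>
    ball ((T ^^ k) \<alpha>) (inverse (real (Suc j))) \<noteq> {}})"
  define \<F> where "\<F> = (\<Inter>i\<in>{1..} \<times> UNIV. G i)"
  have "residual \<F>"
    unfolding \<F>_def
    by (rule residual_INT)
      (auto simp: G_def intro!: open_repetition_functions
        dense_repetition_functions[OF assms(1) \<open>bij T\<close> assms(4), simplified])
  moreover have "\<exists>\<Omega>\<^sub>f :: 'a set. residual \<Omega>\<^sub>f \<and>
      (\<forall>\<omega>\<in>\<Omega>\<^sub>f. gordon_potential (\<lambda>n. apply_bcontfun f (int_iter T n \<omega>)))" if "f \<in> \<F>" for f
  proof (intro exI conjI ballI)
    have "\<exists>\<omega>\<in>repetition_points T m f. dist \<omega> x < e" if "m \<ge> 1" "e > 0" for m x e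
    proof -
      obtain k where k: "dist ((T ^^ k) \<alpha>) x < e / 2"
        using assms(5) \<open>e > 0\<close> closure_approachable[of x "range (\<lambda>n. (T ^^ n) \<alpha>)"]
        by (auto dest!: spec[of _ "e / 2"])
      obtain j where j: "inverse (real (Suc j)) < e / 2"
        using reals_Archimedean[of "e / 2"] \<open>e > 0\<close> by auto
      have "f \<in> G (m, k, j)" using \<open>f \<in> \<F>\<close> \<open>m \<ge> 1\<close> by (auto simp: \<F>_def)
      then obtain \<omega> where \<omega>: "\<omega> \<in> repetition_points T m f"
        and "dist ((T ^^ k) \<alpha>) \<omega> < inverse (real (Suc j))"
        by (auto simp: G_def)
      then have "dist ((T ^^ k) \<alpha>) \<omega> < e / 2"
        using j by linarith
      then have "dist \<omega> x < e"
        using k by (rule dist_triangle_half_r)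
      with \<omega> show ?thesis by blast
    qed
    then show "residual (\<Inter>m\<in>{1..}. repetition_points T m f)"
      by (intro residual_INT open_repetition_points[OF S]) (auto simp: closure_approachable)
    fix \<omega> assume "\<omega> \<in> (\<Inter>m\<in>{1..}. repetition_points T m f)"
    then show "gordon_potential (\<lambda>n. apply_bcontfun f (int_iter T n \<omega>))"
      by (intro gordon_potential_of_repetitions
          bounded_subset[OF bounded_apply_bcontfun[of f]]) (auto simp: repetition_points_def)
  qed
  ultimately show ?thesis by blast
qed

end
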